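(* Let $F=f+h$ be as in the context, suppose $f$ is H\"older smooth with exponent $\nu\in[0,1]$ and constant $L_\nu>0$, and let $\rho>0$, $\bar x\in\operatorname{dom}F$. Consider the sequence generated by ProxBundle with center $\bar x$ and parameter $\rho$ (run without termination), and let $\delta_j$ be the proximal-value gap at inner iteration $j$. If $\delta_0=0$, then $\delta_j=0$ for every $j\ge0$. Otherwise, for every $j\ge1$, $$\delta_j\le\begin{cases}\left(1+\dfrac{\rho}{L_1}\right)^{-j}\delta_0,&\text{if }\nu=1,\\[1.2em]\max\left\{\delta_0e^{-j/2},\left(\dfrac{4(1+\nu)}{(1-\nu)\rho G_\nu j}\right)^{\frac{1+\nu}{1-\nu}}\right\},&\text{if }\nu\in[0,1),\end{cases}$$ where $G_\nu=\left(\frac{L_\nu}{1+\nu}\right)^{-\frac{2}{1+\nu}}$. In particular, for $\nu\in[0,1)$, $$\delta_j=\mathcal{O}\left(L_\nu^{\frac{2}{1-\nu}}\rho^{-\frac{1+\nu}{1-\nu}}j^{-\frac{1+\nu}{1-\nu}}\right)$$ as $j\to\infty$, with hidden constant depending only on $\nu$ (for all sufficiently large $j$).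
   Context: Problem. $F=f+h$ on $\mathbb{R}^n$, where $f:\mathbb{R}^n\to\mathbb{R}$ is finite-valued and convex and $h:\mathbb{R}^n\to\mathbb{R}\cup\{+\infty\}$ is proper, lower semicontinuous and convex; $F$ attains its minimum. $\partial$ is the convex subdifferential, $\|\cdot\|$ the Euclidean norm. H\"older smoothness with exponent $\nu\in[0,1]$ and constant $L_\nu$: $\|g_x-g_y\|\le L_\nu\|x-y\|^\nu$ for all $x,y\in\mathbb{R}^n$ and all $g_x\in\partial f(x)$, $g_y\in\partial f(y)$ (for $\nu=0$ the right-hand side is $L_0$). ProxBundle with center $\bar x\in\operatorname{dom}F$ and parameter $\rho>0$. Set $z_0=\bar x$. For $j=0,1,2,\dots$: choose any convex model $f_j:\mathbb{R}^n\to\mathbb{R}$ such that (1) $f_j(x)\le f(x)$ for all $x$; (2) for some $g_j\in\partial f(z_j)$, $f_j(x)\ge f(z_j)+\langle g_j,x-z_j\rangle$ for all $x$; (3) if $j\ge1$, there exist $a_j\in\partial f_{j-1}(z_j)$ and $b_j\in\partial h(z_j)$ with $a_j+b_j=\rho(\bar x-z_j)$ such that $f_j(x)\ge f_{j-1}(z_j)+\langle a_j,x-z_j\rangle$ for all $x$. Let $F_j=f_j+h$ and $z_{j+1}=\arg\min_x\{F_j(x)+\frac{\rho}{2}\|x-\bar x\|^2\}$. Quantities: $F_{1/\rho}(\bar x)=\min_x\{F(x)+\frac{\rho}{2}\|x-\bar x\|^2\}$, $m_j=\min_x\{F_j(x)+\frac{\rho}{2}\|x-\bar x\|^2\}$,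 and the proximal-value gap $\delta_j=F_{1/\rho}(\bar x)-m_j$ (which is nonnegative). *)

theory Defs
  imports "HOL-Analysis.Analysis"
begin

section \<open>Extended-real-valued convex functions\<close>

definition proper_fun :: "('a \<Rightarrow> ereal) \<Rightarrow> bool" where
  "proper_fun \<phi> \<longleftrightarrow> (\<forall>x. \<phi> x \<noteq> -\<infinity>) \<and> (\<exists>x. \<phi> x \<noteq> \<infinity>)"

definition lsc_fun :: "('a::topological_space \<Rightarrow> ereal) \<Rightarrow> bool" where
  "lsc_fun \<phi> \<longleftrightarrow> (\<forall>x. \<phi> x \<le> Liminf (at x) \<phi>)"

text \<open>The extended-real analogue of \<^const>\<open>convex_on\<close>; meant for functions that avoid
  \<open>-\<infinity>\<close>, so that no sum \<open>\<infinity> + (-\<infinity>)\<close> occurs.\<close>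

definition ext_convex :: "('a::real_vector \<Rightarrow> ereal) \<Rightarrow> bool" where
  "ext_convex \<phi> \<longleftrightarrow> (\<forall>x y. \<forall>u\<ge>0. \<forall>v\<ge>0. u + v = 1 \<longrightarrow>
     \<phi> (u *\<^sub>R x + v *\<^sub>R y) \<le> ereal u * \<phi> x + ereal v * \<phi> y)"

definition eff_dom :: "('a \<Rightarrow> ereal) \<Rightarrow> 'a set" where
  "eff_dom \<phi> = {x. \<phi> x < \<infinity>}"

text \<open>The subdifferential is empty at points where the function is not finite.\<close>

definition subdiff :: "('a::real_inner \<Rightarrow> ereal) \<Rightarrow> 'a \<Rightarrow> 'a set" where
  "subdiff \<phi> x = {g. \<bar>\<phi> x\<bar> \<noteq> \<infinity> \<and> (\<forall>y. \<phi> x + ereal (g \<bullet> (y - x)) \<le> \<phi> y)}"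

abbreviation subdiff_real :: "('a::real_inner \<Rightarrow> real) \<Rightarrow> 'a \<Rightarrow> 'a set" where
  "subdiff_real f \<equiv> subdiff (\<lambda>x. ereal (f x))"

definition composite :: "('a \<Rightarrow> real) \<Rightarrow> ('a \<Rightarrow> ereal) \<Rightarrow> 'a \<Rightarrow> ereal" where
  "composite f h x = ereal (f x) + h x"

text \<open>The case distinction is needed because \<open>0 powr 0 = 0\<close>: for exponent \<open>0\<close> the bound is
  the constant \<open>L\<close>, also for two subgradients at the same point.\<close>

definition hoelder_smooth :: "real \<Rightarrow> real \<Rightarrow> ('a::real_inner \<Rightarrow> real) \<Rightarrow> bool" where
  "hoelder_smooth \<nu> L f \<longleftrightarrow> (\<forall>x y. \<forall>gx\<in>subdiff_real f x. \<forall>gy\<in>subdiff_real f y.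
     norm (gx - gy) \<le> L * (if \<nu> = 0 then 1 else norm (x - y) powr \<nu>))"

section \<open>The proximal bundle procedure\<close>

definition prox_objective :: "real \<Rightarrow> 'a::real_inner \<Rightarrow> ('a \<Rightarrow> ereal) \<Rightarrow> 'a \<Rightarrow> ereal" where
  "prox_objective \<rho> c \<phi> x = \<phi> x + ereal (\<rho> / 2 * (norm (x - c))\<^sup>2)"

definition prox_value :: "real \<Rightarrow> 'a::real_inner \<Rightarrow> ('a \<Rightarrow> ereal) \<Rightarrow> ereal" where
  "prox_value \<rho> c \<phi> = (INF x. prox_objective \<rho> c \<phi> x)"

text \<open>\<open>prox_bundle f h \<rho> c fm z\<close>: the models \<open>fm j\<close> and the iterates \<open>z j\<close> form a possible
  infinite run with center \<open>c\<close>. The models are otherwise arbitrary.\<close>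

definition prox_bundle ::
    "('a::real_inner \<Rightarrow> real) \<Rightarrow> ('a \<Rightarrow> ereal) \<Rightarrow> real \<Rightarrow> 'a \<Rightarrow> (nat \<Rightarrow> 'a \<Rightarrow> real) \<Rightarrow> (nat \<Rightarrow> 'a) \<Rightarrow> bool" where
  "prox_bundle f h \<rho> c fm z \<longleftrightarrow>
     z 0 = c \<and>
     (\<forall>j. convex_on UNIV (fm j)) \<and>
     (\<forall>j x. fm j x \<le> f x) \<and>
     (\<forall>j. \<exists>g\<in>subdiff_real f (z j). \<forall>x. f (z j) + g \<bullet> (x - z j) \<le> fm j x) \<and>
     (\<forall>j\<ge>1. \<exists>a\<in>subdiff_real (fm (j - 1)) (z j). \<exists>b\<in>subdiff h (z j).
        a + b = \<rho> *\<^sub>R (c - z j) \<and>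
        (\<forall>x. fm (j - 1) (z j) + a \<bullet> (x - z j) \<le> fm j x)) \<and>
     (\<forall>j. is_arg_min (prox_objective \<rho> c (composite (fm j) h)) (\<lambda>_. True) (z (Suc j)))"

definition prox_gap ::
    "('a::real_inner \<Rightarrow> real) \<Rightarrow> ('a \<Rightarrow> ereal) \<Rightarrow> real \<Rightarrow> 'a \<Rightarrow> (nat \<Rightarrow> 'a \<Rightarrow> real) \<Rightarrow> nat \<Rightarrow> ereal" where
  "prox_gap f h \<rho> c fm j =
     prox_value \<rho> c (composite f h) - prox_value \<rho> c (composite (fm j) h)"

definition G_const :: "real \<Rightarrow> real \<Rightarrow> real" where
  "G_const \<nu> L = (L / (1 + \<nu>)) powr (- (2 / (1 + \<nu>)))"

text \<open>The constant hidden in the asymptotic bound, i.e. what remains of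
  \<open>(4 (1 + \<nu>) / ((1 - \<nu>) \<rho> G j)) powr ((1 + \<nu>) / (1 - \<nu>))\<close> once the powers of \<open>L\<close>, \<open>\<rho>\<close> and \<open>j\<close> are
  split off. It is given as a closed term because an existential quantifier inside a theorem
  about \<open>real ^ 'n\<close> would let the constant depend on the dimension.\<close>

definition gap_rate_const :: "real \<Rightarrow> real" where
  "gap_rate_const \<nu> = (4 * (1 + \<nu>) / (1 - \<nu>)) powr ((1 + \<nu>) / (1 - \<nu>))
     * (1 + \<nu>) powr (- (2 / (1 - \<nu>)))"

end

theory Submission
  imports Defs
begin

text \<open>Write \<open>d\<close> for the distance between the iterates \<open>z (Suc j)\<close> and \<open>z (Suc (Suc j))\<close>. The
  aggregate cut gives \<open>\<delta> j - \<delta> (Suc j) \<ge> \<rho> / 2 * d\<^sup>2\<close>, while the cut of slope \<open>g\<close> at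
  \<open>z (Suc j)\<close> and Hoelder smoothness give \<open>\<delta> (Suc j) \<le> L / (1 + \<nu>) * d powr (1 + \<nu>)\<close>.
  Eliminating \<open>d\<close> yields \<open>\<delta> (Suc j) + \<rho> / 2 * G * \<delta> (Suc j) powr (2 / (1 + \<nu>)) \<le> \<delta> j\<close>, which is
  geometric decay for \<open>\<nu> = 1\<close>. For \<open>\<nu> < 1\<close> put \<open>q = 2 / (1 + \<nu>) - 1\<close>, \<open>c = \<rho> / 2 * G\<close> and
  \<open>x j = c * \<delta> j powr q\<close>. A step decreases \<open>ln (\<delta> j)\<close> by at least \<open>ln (1 + x)\<close> and increases
  \<open>\<delta> j powr (- q)\<close> by at least \<open>q * c / (1 + x)\<close>, with \<open>x\<close> taken after the step. Since
  \<open>ln (1 + x) + 1 / (1 + x) \<ge> 1\<close>, after \<open>j\<close> steps one of the two sums of these quantities (without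
  the factor \<open>q * c\<close>) is at least \<open>j / 2\<close>; this is where the maximum of two rates comes from.\<close>

section \<open>Subgradients and growth of Hoelder smooth convex functions\<close>

text \<open>Separate \<open>(x, f x)\<close> from the strict epigraph. Dividing the horizontal part
  of the normal vector by minus its vertical part gives a subgradient.\<close>

lemma convex_subdiff_real_nonempty:
  fixes f :: "'a::euclidean_space \<Rightarrow> real"
  assumes "convex_on UNIV f"
  shows "\<exists>g. g \<in> subdiff_real f x"
proof -
  let ?S = "{p :: 'a \<times> real. f (fst p) < snd p}"
  have "convex ?S"
  proof (rule convexI)
    fix p q :: "'a \<times> real" and u v :: real
    assume pq: "p \<in> ?S" "q \<in> ?S" and uv: "0 \<le> u" "0 \<le> v" "u + v = 1"
    have "f (u *\<^sub>R fst p + v *\<^sub>R fst q) \<le> u * f (fst p) + v * f (fst q)"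
      using assms uv unfolding convex_on_def by auto
    also have "\<dots> < u * snd p + v * snd q"
    \<comment> \<open>Strictness comes from a point with positive weight: \<open>p\<close> if
      \<open>u > 0\<close>, and otherwise \<open>q\<close>.\<close>
    proof (cases "u = 0")
      case False
      then have "u * f (fst p) < u * snd p" using pq uv by auto
      moreover have "v * f (fst q) \<le> v * snd q" using pq uv by (auto intro: mult_left_mono)
      ultimately show ?thesis by simp
    qed (use pq uv in auto)
    finally show "u *\<^sub>R p + v *\<^sub>R q \<in> ?S" by simp
  qed
  moreover have "(0, f 0 + 1) \<in> ?S" by simp
  then have "?S \<noteq> {}" by blast
  moreover have "convex {(x, f x)}" "{(x, f x)} \<noteq> {}" "{(x, f x)} \<inter> ?S = {}" by auto
  ultimately obtain w \<beta> where w: "w \<noteq> 0" "\<forall>p\<in>{(x, f x)}. w \<bullet> p \<le> \<beta>" "\<forall>p\<in>?S. w \<bullet> p \<ge> \<beta>"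
    using separating_hyperplane_sets[of "{(x, f x)}" ?S] by blast
  obtain a b where ab: "w = (a, b)" by fastforce
  have sep: "a \<bullet> x + b * f x \<le> a \<bullet> y + b * t" if "f y < t" for y t
    using w(2) w(3)[rule_format, of "(y, t)"] that ab by (auto simp: inner_Pair)
  have "0 \<le> b" using sep[of x "f x + 1"] by (simp add: algebra_simps)
  \<comment> \<open>A vertical hyperplane would make the functional \<open>a\<close> minimal at
    \<open>x\<close> over the whole space; the test point \<open>x - a\<close> refutes this.\<close>
  moreover have "b \<noteq> 0"
  proof
    assume "b = 0"
    then have "a \<bullet> a \<le> 0"
      using sep[of "x - a" "f (x - a) + 1"] by (simp add: inner_diff_right)
    then show False using \<open>b = 0\<close> w(1) ab by (simp add: zero_prod_def inner_gt_zero_iff flip: not_less)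
  qed
  ultimately have "0 < b" by simp
  have "f x + (- (1 / b) *\<^sub>R a) \<bullet> (y - x) \<le> f y" for y
  proof (rule field_le_epsilon)
    fix e :: real assume "0 < e"
    then have "a \<bullet> x + b * f x \<le> a \<bullet> y + b * (f y + e)" by (intro sep) simp
    then show "f x + (- (1 / b) *\<^sub>R a) \<bullet> (y - x) \<le> f y + e"
      using \<open>0 < b\<close> by (simp add: inner_diff_right field_simps)
  qed
  then have "- (1 / b) *\<^sub>R a \<in> subdiff_real f x" unfolding subdiff_def by simp
  then show ?thesis ..
qed

text \<open>Mean value theorem plus monotonicity of \<open>t powr \<nu>\<close>. At
  \<open>a = 0\<close> the left side vanishes even for \<open>\<nu> = 0\<close>, since
  \<open>0 powr 0 = 0\<close>.\<close>

lemma powr_above_tangent: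
  fixes a b \<nu> :: real
  assumes "0 \<le> \<nu>" "0 \<le> a" "a \<le> b"
  shows "(1 + \<nu>) * a powr \<nu> * (b - a) \<le> b powr (1 + \<nu>) - a powr (1 + \<nu>)"
proof (cases "0 < a \<and> a < b")
  case True
  have "\<exists>\<xi>. a < \<xi> \<and> \<xi> < b \<and>
      b powr (1 + \<nu>) - a powr (1 + \<nu>) = (b - a) * ((1 + \<nu>) * \<xi> powr (1 + \<nu> - 1))"
    using True by (intro MVT2 has_real_derivative_powr) auto
  then obtain \<xi> where \<xi>: "a < \<xi>"
    "b powr (1 + \<nu>) - a powr (1 + \<nu>) = (b - a) * ((1 + \<nu>) * \<xi> powr \<nu>)" by auto
  have "a powr \<nu> \<le> \<xi> powr \<nu>" using \<xi> True assms by (intro powr_mono2) auto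
  then have "(b - a) * ((1 + \<nu>) * a powr \<nu>) \<le> (b - a) * ((1 + \<nu>) * \<xi> powr \<nu>)"
    using True assms by (intro mult_left_mono) auto
  then show ?thesis using \<xi> by (simp add: mult_ac)
qed (use assms in auto)

text \<open>Comparing \<open>f\<close> along the segment with a Riemann sum of subgradients, instead of
  integrating a gradient, also covers \<open>\<nu> = 0\<close>, where \<open>f\<close> need not be differentiable.\<close>

lemma hoelder_smooth_upper_bound:
  fixes f :: "'a::euclidean_space \<Rightarrow> real"
  assumes "convex_on UNIV f" "hoelder_smooth \<nu> L f" "0 \<le> \<nu>" "0 \<le> L"
    and g: "g \<in> subdiff_real f x"
  shows "f y \<le> f x + g \<bullet> (y - x) + L / (1 + \<nu>) * norm (y - x) powr (1 + \<nu>)"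
proof (cases "y = x")
  case False
  define d where "d = y - x"
  define r where "r = norm d"
  have r: "0 < r" using False by (simp add: r_def d_def)
  \<comment> \<open>\<open>u\<close> is the grid point after \<open>t\<close>. The subgradient at
    the right end \<open>t\<close> overestimates the rise of \<open>f\<close> over the cell from
    \<open>s\<close> to \<open>t\<close>; the resulting Hoelder term is absorbed by the increase of
    the power function over the next cell, of equal length, by its tangent at
    \<open>t\<close>.\<close>
  have step: "f (x + t *\<^sub>R d) - f (x + s *\<^sub>R d) - (t - s) * (g \<bullet> d)
      \<le> L / (1 + \<nu>) * ((r * u) powr (1 + \<nu>) - (r * t) powr (1 + \<nu>))"
    if st: "0 \<le> s" "s < t" "u - t = t - s" for s t u :: real
  proof -
    obtain g' where g': "g' \<in> subdiff_real f (x + t *\<^sub>R d)"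
      using convex_subdiff_real_nonempty[OF assms(1)] by blast
    then have "\<forall>v. f (x + t *\<^sub>R d) + g' \<bullet> (v - (x + t *\<^sub>R d)) \<le> f v"
      unfolding subdiff_def by simp
    from this[rule_format, of "x + s *\<^sub>R d"]
    have "f (x + t *\<^sub>R d) + g' \<bullet> ((x + s *\<^sub>R d) - (x + t *\<^sub>R d)) \<le> f (x + s *\<^sub>R d)" .
    then have 1: "f (x + t *\<^sub>R d) - f (x + s *\<^sub>R d) \<le> (t - s) * (g' \<bullet> d)"
      by (simp add: inner_diff_right algebra_simps)
    have "norm (g' - g) \<le> L * (if \<nu> = 0 then 1 else norm (x + t *\<^sub>R d - x) powr \<nu>)"
      using assms(2) g' g unfolding hoelder_smooth_def by blast
    \<comment> \<open>Here \<open>r * t > 0\<close>, so for \<open>\<nu> = 0\<close> the power is 1,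
      matching the case distinction.\<close>
    also have "\<dots> = L * (r * t) powr \<nu>"
      using r st by (auto simp: r_def mult.commute)
    finally have "(g' - g) \<bullet> d \<le> L * (r * t) powr \<nu> * r"
      using norm_cauchy_schwarz[of "g' - g" d] mult_right_mono[of "norm (g' - g)" _ "norm d"]
      unfolding r_def by fastforce
    then have "(t - s) * ((g' - g) \<bullet> d) \<le> (t - s) * (L * (r * t) powr \<nu> * r)"
      using st by (intro mult_left_mono) auto
    also have "\<dots> = L / (1 + \<nu>) * ((1 + \<nu>) * (r * t) powr \<nu> * (r * u - r * t))"
      using assms(3) st by (simp add: right_diff_distrib[symmetric])
    also have "\<dots> \<le> L / (1 + \<nu>) * ((r * u) powr (1 + \<nu>) - (r * t) powr (1 + \<nu>))"
      using assms r st by (intro mult_left_mono powr_above_tangent) auto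
    finally show ?thesis using 1 by (simp add: inner_diff_left algebra_simps)
  qed
  \<comment> \<open>Summing over \<open>N = n + 1\<close> equal cells telescopes. The shift by one
    cell leaves the endpoint \<open>1 + 1 / N\<close> in place of 1, which is repaired in the
    limit.\<close>
  have bound: "f y - f x - g \<bullet> d \<le> L / (1 + \<nu>) * (r * (1 + inverse (real (Suc n)))) powr (1 + \<nu>)" for n
  proof -
    define N where "N = real (Suc n)"
    have N: "0 < N" by (simp add: N_def)
    have "f (x + (real k / N) *\<^sub>R d) - f x - real k / N * (g \<bullet> d)
        \<le> L / (1 + \<nu>) * (r * (real (Suc k) / N)) powr (1 + \<nu>)" for k
    proof (induction k)
      case (Suc k)
      have "f (x + (real (Suc k) / N) *\<^sub>R d) - f (x + (real k / N) *\<^sub>R d)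
          - (real (Suc k) / N - real k / N) * (g \<bullet> d)
        \<le> L / (1 + \<nu>) * ((r * (real (Suc (Suc k)) / N)) powr (1 + \<nu>) - (r * (real (Suc k) / N)) powr (1 + \<nu>))"
        using N by (intro step) (auto simp: divide_strict_right_mono diff_divide_distrib[symmetric])
      with Suc.IH show ?case by (simp add: algebra_simps)
    qed (use assms in auto)
    moreover have "real (Suc n) / N = 1" "real (Suc (Suc n)) / N = 1 + inverse (real (Suc n))"
      by (simp_all add: N_def field_simps)
    moreover have "x + 1 *\<^sub>R d = y" by (simp add: d_def)
    ultimately show ?thesis by (metis mult_1)
  qed
  have "(\<lambda>n. L / (1 + \<nu>) * (r * (1 + inverse (real (Suc n)))) powr (1 + \<nu>))
      \<longlonglongrightarrow> L / (1 + \<nu>) * (r * (1 + 0)) powr (1 + \<nu>)"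
    using r by (intro tendsto_intros LIMSEQ_inverse_real_of_nat) auto
  from LIMSEQ_le_const[OF this] bound
  have "f y - f x - g \<bullet> d \<le> L / (1 + \<nu>) * r powr (1 + \<nu>)" by auto
  then show ?thesis by (simp add: d_def r_def)
qed simp

section \<open>Scalar inequalities and decay rates\<close>

text \<open>Weighted arithmetic-geometric means of \<open>1 / (1 + x)\<close> and 1 with weights
  \<open>q\<close> and \<open>1 - q\<close>. It serves to bound the growth of
  \<open>D n powr (- q)\<close> from below.\<close>

lemma powr_Bernoulli_le:
  fixes x q :: real
  assumes "0 \<le> x" "0 \<le> q" "q \<le> 1"
  shows "(1 + x) powr (- q) \<le> 1 - q * (x / (1 + x))"
proof -
  have "inverse (1 + x) powr q * 1 powr (1 - q) \<le> q * inverse (1 + x) + (1 - q) * 1"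
    using assms by (intro Youngs_inequality_0) auto
  moreover have "q * inverse (1 + x) + (1 - q) * 1 = 1 - q * (x / (1 + x))"
    using assms by (simp add: field_simps)
  moreover have "inverse (1 + x) powr q = (1 + x) powr (- q)"
    using assms by (simp add: powr_minus inverse_powr)
  ultimately show ?thesis by simp
qed

lemma superlinear_recursion_bound:
  fixes D :: "nat \<Rightarrow> real" and c p :: real
  assumes rec: "\<And>n. D (Suc n) + c * D (Suc n) powr p \<le> D n"
    and pos: "\<And>n. 0 \<le> D n" and c: "0 < c" and p: "1 < p" "p \<le> 2" and j: "1 \<le> j"
  shows "D j \<le> max (D 0 * exp (- real j / 2)) ((2 / ((p - 1) * c * real j)) powr (1 / (p - 1)))"
proof (cases "D j = 0")
  case True
  then show ?thesis by (simp add: max.coboundedI2)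
next
  case False
  define q where "q = p - 1"
  have q: "0 < q" "q \<le> 1" using p by (auto simp: q_def)
  have "antimono D"
    by (rule decseq_SucI) (smt (verit) rec c mult_nonneg_nonneg powr_ge_zero)
  \<comment> \<open>Logarithms and negative powers need positive values; monotonicity carries
    \<open>D j > 0\<close> back to all earlier indices.\<close>
  then have Dpos: "0 < D i" if "i \<le> j" for i
    using that False pos[of j] by (smt (verit) antimonoD)
  define x where "x i = c * D i powr q" for i
  have x: "0 < x i" if "i \<le> j" for i using c Dpos[OF that] by (simp add: x_def)
  have rec': "D (Suc i) * (1 + x (Suc i)) \<le> D i" if "Suc i \<le> j" for i
    using rec[of i] Dpos[OF that] powr_add[of "D (Suc i)" 1 q]
    by (simp add: x_def q_def algebra_simps)
  have A: "(\<Sum>i<n. ln (1 + x (Suc i))) \<le> ln (D 0) - ln (D n)" if "n \<le> j" for n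
    using that
  proof (induction n)
    case (Suc n)
    have "ln (D (Suc n)) + ln (1 + x (Suc n)) \<le> ln (D n)"
    proof -
      have "ln (D (Suc n)) + ln (1 + x (Suc n)) = ln (D (Suc n) * (1 + x (Suc n)))"
        using Dpos[OF Suc.prems] x[OF Suc.prems] by (simp add: ln_mult)
      also have "\<dots> \<le> ln (D n)"
        using rec'[OF Suc.prems] Dpos[OF Suc.prems] x[OF Suc.prems] by (intro ln_mono) auto
      finally show ?thesis .
    qed
    with Suc show ?case by simp
  qed simp
  \<comment> \<open>Here \<open>p \<le> 2\<close> enters, as \<open>q \<le> 1\<close> in the
    Bernoulli-type estimate. The initial value \<open>D 0 powr (- q)\<close> is bounded below by
    0.\<close>
  have B: "q * c * (\<Sum>i<n. 1 / (1 + x (Suc i))) \<le> D n powr (- q)" if "n \<le> j" for n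
    using that
  proof (induction n)
    case (Suc n)
    let ?D = "D (Suc n)" and ?x = "x (Suc n)"
    have D: "0 < ?D" "0 < ?x" using Suc.prems Dpos x by auto
    have "D n powr (- q) \<le> (?D * (1 + ?x)) powr (- q)"
      using rec'[OF Suc.prems] D q by (intro powr_mono2') auto
    also have "\<dots> = ?D powr (- q) * (1 + ?x) powr (- q)" using D by (simp add: powr_mult)
    also have "\<dots> \<le> ?D powr (- q) * (1 - q * (?x / (1 + ?x)))"
      using D q by (intro mult_left_mono powr_Bernoulli_le) auto
    also have "\<dots> = ?D powr (- q) - q * (?D powr (- q) * ?x) / (1 + ?x)"
      by (simp add: algebra_simps)
    also have "?D powr (- q) * ?x = c" using D by (simp add: x_def powr_minus)
    finally show ?case using Suc by (simp add: algebra_simps)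
  qed simp
  \<comment> \<open>This is \<open>ln y \<le> y - 1\<close> at
    \<open>y = 1 / (1 + x (Suc i))\<close>.\<close>
  have "1 \<le> ln (1 + x (Suc i)) + 1 / (1 + x (Suc i))" if "i < j" for i
    using ln_le_minus_one[of "1 / (1 + x (Suc i))"] x[of "Suc i"] that by (simp add: ln_div)
  then have "(\<Sum>i<j. 1) \<le> (\<Sum>i<j. ln (1 + x (Suc i)) + 1 / (1 + x (Suc i)))"
    by (intro sum_mono) auto
  then have "real j \<le> (\<Sum>i<j. ln (1 + x (Suc i))) + (\<Sum>i<j. 1 / (1 + x (Suc i)))"
    by (simp add: sum.distrib)
  then consider "real j / 2 \<le> (\<Sum>i<j. ln (1 + x (Suc i)))"
    | "real j / 2 \<le> (\<Sum>i<j. 1 / (1 + x (Suc i)))" by linarith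
  then show ?thesis
  proof cases
    case 1
    with A[of j] have "ln (D j) \<le> ln (D 0 * exp (- real j / 2))"
      using Dpos[of 0] by (simp add: ln_mult)
    then have "D j \<le> D 0 * exp (- real j / 2)" using Dpos by (subst (asm) ln_le_cancel_iff) auto
    then show ?thesis by simp
  next
    case 2
    have "q * c * (real j / 2) \<le> q * c * (\<Sum>i<j. 1 / (1 + x (Suc i)))"
      using 2 q c by (intro mult_left_mono) auto
    also have "\<dots> \<le> D j powr (- q)" by (intro B) simp
    \<comment> \<open>The decreasing power \<open>- (1 / q)\<close> isolates \<open>D j\<close>; the
      2 in the rate comes from \<open>j / 2\<close>.\<close>
    finally have "(D j powr (- q)) powr (- (1 / q)) \<le> (q * c * (real j / 2)) powr (- (1 / q))"
      using q c j by (intro powr_mono2') auto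
    then have "D j \<le> (q * c * (real j / 2)) powr (- (1 / q))"
      using q Dpos[of j] by (simp add: powr_powr)
    also have "\<dots> = (2 / (q * c * real j)) powr (1 / q)"
      using q c j by (simp add: powr_minus inverse_powr[symmetric])
    finally show ?thesis by (simp add: q_def)
  qed
qed

text \<open>Lets the power term win in the maximum of the two rates for large \<open>j\<close>,
  whatever the constants.\<close>

lemma eventually_exp_le_powr:
  fixes A K s :: real
  assumes "0 < K" "0 \<le> A"
  shows "\<forall>\<^sub>F j in sequentially. A * exp (- real j / 2) \<le> K * real j powr (- s)"
proof -
  \<comment> \<open>A natural exponent above \<open>s\<close> (0 for negative \<open>s\<close>)
    gives access to the limit of \<open>t ^ k / exp t\<close> at \<open>t = j / 2\<close>; the
    factor \<open>2 ^ k\<close> below restores \<open>j ^ k\<close>.\<close>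
  define k where "k = nat \<lceil>s\<rceil>"
  have "filterlim (\<lambda>j. (1 / 2) * real j) at_top sequentially"
    by (intro filterlim_tendsto_pos_mult_at_top[OF tendsto_const] filterlim_real_sequentially) simp
  from filterlim_compose[OF tendsto_power_div_exp_0[of k] this]
  have "(\<lambda>j. (A * 2 ^ k) * (((1 / 2) * real j) ^ k / exp ((1 / 2) * real j))) \<longlonglongrightarrow> (A * 2 ^ k) * 0"
    by (intro tendsto_mult tendsto_const)
  then have "\<forall>\<^sub>F j in sequentially. (A * 2 ^ k) * (((1 / 2) * real j) ^ k / exp ((1 / 2) * real j)) < K"
    using assms by (intro order_tendstoD) auto
  then show ?thesis using eventually_ge_at_top[of "1::nat"]
  proof eventually_elim
    case (elim j)
    have "real j powr s \<le> real j powr real k"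
      using elim real_nat_ceiling_ge[of s] by (intro powr_mono) (auto simp: k_def)
    then have "A * exp (- real j / 2) * real j powr s \<le> A * exp (- real j / 2) * real j ^ k"
      using assms elim by (intro mult_left_mono) (auto simp: powr_realpow)
    also have "\<dots> \<le> K" using elim by (simp add: exp_minus field_simps)
    finally show ?case using elim by (simp add: powr_minus field_simps)
  qed
qed

section \<open>One-step recursion for the proximal gap\<close>

text \<open>The real sequence \<open>D\<close> also records that the gaps are finite: the center
  bounds the proximal value of \<open>composite f h\<close> from above, the attained model value
  bounds it from below.\<close>

lemma prox_bundle_gap_recursion:
  fixes f :: "'a::euclidean_space \<Rightarrow> real"
  assumes "convex_on UNIV f" "proper_fun h" "0 \<le> \<nu>" "0 < L" "hoelder_smooth \<nu> L f" "0 < \<rho>"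
    and center: "c \<in> eff_dom (composite f h)" and run: "prox_bundle f h \<rho> c fm z"
  obtains D where "\<And>j. prox_gap f h \<rho> c fm j = ereal (D j)" "\<And>j. 0 \<le> D j"
    "\<And>j. D (Suc j) + \<rho> / 2 * G_const \<nu> L * D (Suc j) powr (2 / (1 + \<nu>)) \<le> D j"
proof -
  \<comment> \<open>\<open>real_of_ereal\<close> sends infinity to 0, so \<open>H\<close> represents
    \<open>h\<close> only where \<open>h\<close> is finite; it is evaluated only at such
    points.\<close>
  define H where "H x = real_of_ereal (h x)" for x
  define Q where "Q x = \<rho> / 2 * (norm (x - c))\<^sup>2" for x
  define M where "M j = fm j (z (Suc j)) + H (z (Suc j)) + Q (z (Suc j))" for j
  have hfin: "h x = ereal (H x)" if "h x \<noteq> \<infinity>" for x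
    using that assms(2) unfolding proper_fun_def H_def by (cases "h x") auto
  have hc: "h c \<noteq> \<infinity>" using center unfolding eff_dom_def composite_def by auto
  have obj: "prox_objective \<rho> c (composite \<phi> h) x = ereal (\<phi> x + H x + Q x)"
    if "h x \<noteq> \<infinity>" for \<phi> x
    using hfin[OF that] by (simp add: prox_objective_def composite_def Q_def)
  have obj_inf: "prox_objective \<rho> c (composite \<phi> h) x = \<infinity>" if "h x = \<infinity>" for \<phi> x
    using that by (simp add: prox_objective_def composite_def)
  have argmin: "prox_objective \<rho> c (composite (fm j) h) (z (Suc j))
      \<le> prox_objective \<rho> c (composite (fm j) h) x" for j x
    using run unfolding prox_bundle_def is_arg_min_def by (auto simp: not_less)
  \<comment> \<open>Comparison with \<open>c\<close>, where the objective is finite, keeps the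
    minimisers in the domain of \<open>h\<close>.\<close>
  have hz: "h (z (Suc j)) \<noteq> \<infinity>" for j
    using argmin[of j c] obj[OF hc, of "fm j"] obj_inf[of "z (Suc j)" "fm j"] by auto
  have model_value: "prox_value \<rho> c (composite (fm j) h) = ereal (M j)" for j
    unfolding prox_value_def
  proof (rule antisym)
    show "(INF x. prox_objective \<rho> c (composite (fm j) h) x) \<le> ereal (M j)"
      unfolding M_def obj[OF hz, symmetric] by (rule INF_lower) simp
    show "ereal (M j) \<le> (INF x. prox_objective \<rho> c (composite (fm j) h) x)"
      unfolding M_def obj[OF hz, symmetric] by (intro INF_greatest argmin)
  qed
  have model_le: "fm j x \<le> f x" for j x using run unfolding prox_bundle_def by blast
  have M_le: "ereal (M j) \<le> prox_value \<rho> c (composite f h)" for j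
    unfolding model_value[symmetric] prox_value_def
    by (intro INF_mono') (auto simp: prox_objective_def composite_def model_le intro!: add_right_mono)
  have P_le: "prox_value \<rho> c (composite f h) \<le> ereal (f x + H x + Q x)" if "h x \<noteq> \<infinity>" for x
    unfolding prox_value_def obj[OF that, symmetric] by (rule INF_lower) simp
  obtain P where P: "prox_value \<rho> c (composite f h) = ereal P"
    using M_le[of 0] P_le[OF hc] by (cases "prox_value \<rho> c (composite f h)") auto
  define D where "D j = P - M j" for j
  show ?thesis
  proof (rule that)
    show "prox_gap f h \<rho> c fm j = ereal (D j)" for j
      by (simp add: prox_gap_def P model_value D_def)
    show D0: "0 \<le> D j" for j using M_le[of j] by (simp add: P D_def)
    fix j
    define x y where "x = z (Suc j)" and "y = z (Suc (Suc j))"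
    define d where "d = norm (y - x)"
    have "\<exists>a\<in>subdiff_real (fm j) x. \<exists>b\<in>subdiff h x. a + b = \<rho> *\<^sub>R (c - x) \<and>
        (\<forall>v. fm j x + a \<bullet> (v - x) \<le> fm (Suc j) v)"
      using run unfolding prox_bundle_def x_def
      by (metis diff_Suc_1 le_add1 plus_1_eq_Suc)
    then obtain a b where b: "b \<in> subdiff h x" and ab: "a + b = \<rho> *\<^sub>R (c - x)"
      and a: "fm j x + a \<bullet> (y - x) \<le> fm (Suc j) y" by blast
    have "h x + ereal (b \<bullet> (y - x)) \<le> h y" using b unfolding subdiff_def by auto
    then have "H x + b \<bullet> (y - x) \<le> H y"
      using hfin[OF hz] unfolding x_def y_def by simp
    \<comment> \<open>\<open>a + b\<close> is minus the gradient of the quadratic \<open>Q\<close>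
      at \<open>x\<close>, so exactly its second-order term remains.\<close>
    moreover have "Q y - Q x + (a + b) \<bullet> (y - x) = \<rho> / 2 * d\<^sup>2"
      unfolding ab Q_def d_def power2_norm_eq_inner
      by (simp add: inner_diff_left inner_diff_right inner_commute algebra_simps)
    ultimately have "M j + \<rho> / 2 * d\<^sup>2 \<le> M (Suc j)"
      using a unfolding M_def x_def[symmetric] y_def[symmetric] by (simp add: inner_add_left)
    then have decrease: "D (Suc j) + \<rho> / 2 * d\<^sup>2 \<le> D j" by (simp add: D_def)
    obtain g where g: "g \<in> subdiff_real f x" "f x + g \<bullet> (y - x) \<le> fm (Suc j) y"
      using run unfolding prox_bundle_def x_def by blast
    \<comment> \<open>Testing the true problem at \<open>y\<close> cancels \<open>H\<close> and
      \<open>Q\<close>: the gap of model \<open>Suc j\<close>, whose minimiser is \<open>y\<close>,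
      is at most the model error at \<open>y\<close>.\<close>
    have "P \<le> f y + H y + Q y" using P_le[OF hz, of "Suc j"] by (simp add: P y_def)
    then have "D (Suc j) \<le> f y - fm (Suc j) y" by (simp add: D_def M_def y_def)
    also have "\<dots> \<le> L / (1 + \<nu>) * d powr (1 + \<nu>)"
      using hoelder_smooth_upper_bound[OF assms(1,5,3) _ g(1), of y] g(2) assms(4)
      by (simp add: d_def)
    \<comment> \<open>This exponent turns \<open>d powr (1 + \<nu>)\<close> into
      \<open>d\<^sup>2\<close>, and \<open>G_const \<nu> L\<close> is the reciprocal of the factor
      that appears.\<close>
    finally have "D (Suc j) powr (2 / (1 + \<nu>)) \<le> (L / (1 + \<nu>) * d powr (1 + \<nu>)) powr (2 / (1 + \<nu>))"
      using D0 assms(3) by (intro powr_mono2) auto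
    also have "\<dots> = (L / (1 + \<nu>)) powr (2 / (1 + \<nu>)) * d\<^sup>2"
    proof -
      have "(1 + \<nu>) * (2 / (1 + \<nu>)) = 2" using assms(3) by (simp add: field_simps)
      then have "(d powr (1 + \<nu>)) powr (2 / (1 + \<nu>)) = d\<^sup>2"
        unfolding powr_powr by (cases "d = 0") (auto simp: d_def)
      moreover have "0 \<le> L / (1 + \<nu>)" using assms(3,4) by simp
      ultimately show ?thesis by (subst powr_mult) auto
    qed
    finally have "G_const \<nu> L * D (Suc j) powr (2 / (1 + \<nu>))
        \<le> G_const \<nu> L * ((L / (1 + \<nu>)) powr (2 / (1 + \<nu>)) * d\<^sup>2)"
      by (intro mult_left_mono) (auto simp: G_const_def)
    also have "\<dots> = d\<^sup>2"
      using assms(3,4) by (simp add: G_const_def powr_minus)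
    finally have "\<rho> / 2 * (G_const \<nu> L * D (Suc j) powr (2 / (1 + \<nu>))) \<le> \<rho> / 2 * d\<^sup>2"
      using assms(6) by (intro mult_left_mono) auto
    with decrease show "D (Suc j) + \<rho> / 2 * G_const \<nu> L * D (Suc j) powr (2 / (1 + \<nu>)) \<le> D j"
      by (simp add: mult_ac)
  qed
qed

section \<open>Explicit constants and final rates\<close>

lemma gap_rate_eq:
  fixes \<nu> L \<rho> t :: real
  assumes "0 \<le> \<nu>" "\<nu> < 1" "0 < L" "0 < \<rho>" "0 < t"
  shows "(4 * (1 + \<nu>) / ((1 - \<nu>) * \<rho> * G_const \<nu> L * t)) powr ((1 + \<nu>) / (1 - \<nu>))
    = gap_rate_const \<nu> * (L powr (2 / (1 - \<nu>)) * \<rho> powr (- ((1 + \<nu>) / (1 - \<nu>)))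
        * t powr (- ((1 + \<nu>) / (1 - \<nu>))))"
proof -
  define s where "s = (1 + \<nu>) / (1 - \<nu>)"
  \<comment> \<open>This product of exponents is the power of \<open>L\<close> in the asymptotic
    rate.\<close>
  have "2 / (1 + \<nu>) * s = 2 / (1 - \<nu>)" using assms by (simp add: s_def divide_simps)
  then have "G_const \<nu> L powr s = (L / (1 + \<nu>)) powr (- (2 / (1 - \<nu>)))"
    unfolding G_const_def powr_powr minus_mult_left[symmetric] by simp
  also have "\<dots> = (1 + \<nu>) powr (2 / (1 - \<nu>)) / L powr (2 / (1 - \<nu>))"
    using assms by (simp add: powr_divide powr_minus field_simps)
  finally have G: "G_const \<nu> L powr s = (1 + \<nu>) powr (2 / (1 - \<nu>)) / L powr (2 / (1 - \<nu>))" .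
  have "4 * (1 + \<nu>) / ((1 - \<nu>) * \<rho> * G_const \<nu> L * t) = 4 * (1 + \<nu>) / (1 - \<nu>) / (\<rho> * G_const \<nu> L * t)"
    by simp
  then have "(4 * (1 + \<nu>) / ((1 - \<nu>) * \<rho> * G_const \<nu> L * t)) powr s
      = (4 * (1 + \<nu>) / (1 - \<nu>)) powr s / (\<rho> powr s * G_const \<nu> L powr s * t powr s)"
    using assms by (simp add: powr_divide powr_mult G_const_def)
  then show ?thesis unfolding G s_def[symmetric] gap_rate_const_def
    by (simp add: powr_minus field_simps)
qed

theorem corollary1:
  fixes f :: "real ^ 'n \<Rightarrow> real" and h :: "real ^ 'n \<Rightarrow> ereal"
    and \<nu> L \<rho> :: real and xbar :: "real ^ 'n"
    and fm :: "nat \<Rightarrow> real ^ 'n \<Rightarrow> real" and z :: "nat \<Rightarrow> real ^ 'n"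
    and \<delta> :: "nat \<Rightarrow> ereal"
  defines "\<delta> \<equiv> prox_gap f h \<rho> xbar fm"
  assumes f_convex: "convex_on UNIV f"
    and h_proper: "proper_fun h" and h_lsc: "lsc_fun h" and h_convex: "ext_convex h"
    and F_min: "\<exists>x. \<forall>y. composite f h x \<le> composite f h y"
    and nu: "0 \<le> \<nu>" "\<nu> \<le> 1" and L_pos: "0 < L"
    and f_hoelder: "hoelder_smooth \<nu> L f"
    and rho_pos: "0 < \<rho>"
    and center: "xbar \<in> eff_dom (composite f h)"
    and run: "prox_bundle f h \<rho> xbar fm z"
  shows "(\<delta> 0 = 0 \<longrightarrow> (\<forall>j. \<delta> j = 0)) \<and>
    (\<delta> 0 \<noteq> 0 \<longrightarrow> (\<forall>j\<ge>1.
       \<delta> j \<le> (if \<nu> = 1 then ereal ((1 + \<rho> / L) powr (- real j)) * \<delta> 0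
              else max (\<delta> 0 * ereal (exp (- real j / 2)))
                (ereal ((4 * (1 + \<nu>) / ((1 - \<nu>) * \<rho> * G_const \<nu> L * real j))
                          powr ((1 + \<nu>) / (1 - \<nu>))))))) \<and>
    (\<nu> < 1 \<longrightarrow> (\<forall>\<^sub>F j in sequentially.
       \<bar>\<delta> j\<bar> \<le> ereal (gap_rate_const \<nu> * (L powr (2 / (1 - \<nu>))
                 * \<rho> powr (- ((1 + \<nu>) / (1 - \<nu>)))
                 * real j powr (- ((1 + \<nu>) / (1 - \<nu>)))))))"
proof -
  obtain D where D: "\<And>j. \<delta> j = ereal (D j)" and D0: "\<And>j. 0 \<le> D j"
    and rec: "\<And>j. D (Suc j) + \<rho> / 2 * G_const \<nu> L * D (Suc j) powr (2 / (1 + \<nu>)) \<le> D j"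
    unfolding \<delta>_def
    using prox_bundle_gap_recursion[OF f_convex h_proper nu(1) L_pos f_hoelder rho_pos center run]
    by metis
  have G: "0 < G_const \<nu> L" using L_pos nu by (simp add: G_const_def)
  have "antimono D"
    by (rule decseq_SucI)
      (smt (verit) rec G rho_pos mult_pos_pos mult_nonneg_nonneg powr_ge_zero half_gt_zero)
  then have zero: "D j = 0" if "D 0 = 0" for j
    using D0[of j] that antimonoD[of D 0 j] by simp
  have linear: "D j \<le> (1 + \<rho> / L) powr (- real j) * D 0" if "\<nu> = 1" for j
  proof (induction j)
    case (Suc j)
    \<comment> \<open>For \<open>\<nu> = 1\<close> the exponent \<open>2 / (1 + \<nu>)\<close> is 1,
      so the recursion is linear with factor \<open>1 + \<rho> / L\<close>.\<close>
    have "G_const \<nu> L = 2 / L" using that L_pos by (simp add: G_const_def powr_minus)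
    then have "(1 + \<rho> / L) * D (Suc j) \<le> D j"
      using rec[of j] that D0 by (simp add: algebra_simps)
    with Suc.IH have "(1 + \<rho> / L) * D (Suc j) \<le> (1 + \<rho> / L) powr (- real j) * D 0" by simp
    moreover have "(1 + \<rho> / L) powr (- real j) = (1 + \<rho> / L) * (1 + \<rho> / L) powr (- real (Suc j))"
      using L_pos rho_pos powr_add[of "1 + \<rho> / L" 1 "- real (Suc j)"]
      by (simp add: add_pos_pos)
    ultimately have "(1 + \<rho> / L) * D (Suc j) \<le> (1 + \<rho> / L) * ((1 + \<rho> / L) powr (- real (Suc j)) * D 0)"
      by (simp add: mult_ac)
    then show ?case by (rule mult_left_le_imp_le) (use L_pos rho_pos in \<open>simp add: add_pos_pos\<close>)
  qed (use L_pos rho_pos in \<open>simp add: add_pos_pos less_imp_neq[symmetric]\<close>)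
  define R where
    "R j = (4 * (1 + \<nu>) / ((1 - \<nu>) * \<rho> * G_const \<nu> L * real j)) powr ((1 + \<nu>) / (1 - \<nu>))" for j
  have sublinear: "D j \<le> max (D 0 * exp (- real j / 2)) (R j)" if "\<nu> < 1" "1 \<le> j" for j
  proof -
    have p: "2 / (1 + \<nu>) - 1 = (1 - \<nu>) / (1 + \<nu>)" using nu by (simp add: field_simps)
    \<comment> \<open>The exponent \<open>p = 2 / (1 + \<nu>)\<close> satisfies \<open>1 < p\<close>
      and \<open>p \<le> 2\<close>. The 4 in \<open>R\<close> is the 2 of the scalar bound times the
      2 dividing \<open>\<rho>\<close>.\<close>
    have "D j \<le> max (D 0 * exp (- real j / 2))
        ((2 / ((2 / (1 + \<nu>) - 1) * (\<rho> / 2 * G_const \<nu> L) * real j)) powr (1 / (2 / (1 + \<nu>) - 1)))"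
      by (rule superlinear_recursion_bound[of D])
        (use that nu rho_pos G rec D0 in \<open>auto simp: field_simps\<close>)
    then show ?thesis unfolding p R_def by (simp add: mult_ac)
  qed
  have asymptotic: "\<forall>\<^sub>F j in sequentially. \<bar>\<delta> j\<bar> \<le> ereal (gap_rate_const \<nu> * (L powr (2 / (1 - \<nu>))
      * \<rho> powr (- ((1 + \<nu>) / (1 - \<nu>))) * real j powr (- ((1 + \<nu>) / (1 - \<nu>)))))" if "\<nu> < 1"
  proof -
    define K where "K = gap_rate_const \<nu> * (L powr (2 / (1 - \<nu>)) * \<rho> powr (- ((1 + \<nu>) / (1 - \<nu>))))"
    have "0 < K" using that nu L_pos rho_pos by (simp add: K_def gap_rate_const_def)
    \<comment> \<open>With \<open>K\<close> the constant of \<open>R\<close>, the exponential entry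
      of the maximum eventually falls below \<open>R j\<close> itself, so no constant is
      lost.\<close>
    from eventually_exp_le_powr[OF this D0[of 0], of "(1 + \<nu>) / (1 - \<nu>)"]
      eventually_ge_at_top[of "1::nat"]
    show ?thesis
    proof eventually_elim
      case (elim j)
      have "R j = K * real j powr (- ((1 + \<nu>) / (1 - \<nu>)))"
        using gap_rate_eq[OF nu(1) that L_pos rho_pos, of "real j"] elim
        by (simp add: R_def K_def mult_ac)
      with sublinear[OF that] elim have "D j \<le> K * real j powr (- ((1 + \<nu>) / (1 - \<nu>)))" by fastforce
      then show ?case using D0[of j] by (simp add: D K_def mult_ac)
    qed
  qed
  show ?thesis
    using zero linear sublinear asymptotic nu
    by (auto simp: D R_def zero_ereal_def simp flip: ereal_max)
qed

end
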